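(* Let $X_i=U_iZ_i^T\in\mathbb{R}^{m\times n}$ have rank $r$, with $U_i\in\mathbb{R}^{m\times r}$, $U_i^TU_i=I$, and $Z_i\in\mathbb{R}^{n\times r}$ of rank $r$. Let $k\in\{1,2,3,4\}$, $\Delta t\in\mathbb{R}$, $L_1,\dots,L_k\in\mathbb{R}^{m\times n}$, and $\Delta t\,\overline{L}=\sum_{j=1}^k\Delta t^jL_j$. Starting from $X_i$, let $X_{i+1}$ be the result of integrating $\Delta t\,\overline{L}$ with the $k$-th order so-DORK (stable, optimal Dynamically Orthogonal Runge-Kutta) scheme. Then $$\|X_{i+1}\|\le\|X_i+\Delta t\,\overline{L}\|.$$
   Context: $\|\cdot\|$ is the Frobenius norm. $\overline{L}$ is the time-integrated differential operator of a Runge-Kutta scheme, expanded as a perturbation series in $\Delta t$ with coefficients $L_j$. Write $U=U_i$, $Z=Z_i$, $P^\perp=I-UU^T$. The so-DORK corrections are $$\dot U_1=P^\perp L_1Z(Z^TZ)^{-1},$$ $$\dot U_2=\left[P^\perp(L_1L_1^TU+L_2Z)-\dot U_1(U^TL_1Z+Z^TL_1^TU)\right](Z^TZ)^{-1},$$ $$\begin{aligned}\dot U_3=\big[&P^\perp\big(L_1L_1^T\dot U_1+(L_1L_2^T+L_2L_1^T)U+L_3Z\big)-\dot U_2(U^TL_1Z+Z^TL_1^TU)\\&-\dot U_1(U^TL_2Z+Z^TL_2^TU+U^TL_1L_1^TU+\dot U_1^TL_1Z+Z^TL_1^T\dot U_1-\dot U_1^T\dot U_1Z^TZ)\big](Z^TZ)^{-1},\end{aligned}$$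 $$\begin{aligned}\dot U_4=\big[&P^\perp\big(L_1L_1^T\dot U_2+(L_1L_2^T+L_2L_1^T)\dot U_1+(L_1L_3^T+L_3L_1^T+L_2L_2^T)U+L_4Z\big)\\&-\dot U_3(U^TL_1Z+Z^TL_1^TU)\\&-\dot U_2(U^TL_2Z+Z^TL_2^TU+U^TL_1L_1^TU+\dot U_1^TL_1Z+Z^TL_1^T\dot U_1-\dot U_1^T\dot U_1Z^TZ)\\&-\dot U_1\big(U^TL_3Z+Z^TL_3^TU+U^T(L_2L_1^T+L_1L_2^T)U+\dot U_1^TL_2Z+Z^TL_2^T\dot U_1+U^TL_1L_1^T\dot U_1+\dot U_1^TL_1L_1^TU\\&\qquad+\dot U_2^TL_1Z+Z^TL_1^T\dot U_2-\dot U_1^T\dot U_2Z^TZ-\dot U_2^T\dot U_1Z^TZ-\dot U_1^T\dot U_1U^TL_1Z-\dot U_1^T\dot U_1Z^TL_1^TU\big)\big](Z^TZ)^{-1}.\end{aligned}$$ The $k$-th order so-DORK scheme sets $X_{i+1}=U_{i+1}Z_{i+1}^T$ with $$U_{i+1}=\mathrm{orth}\Big(U_i+\sum_{j=1}^k\Delta t^j\dot U_j\Big),\qquad Z_{i+1}=(X_i+\Delta t\,\overline{L})^TU_{i+1}.$$ Here $\mathrm{orth}(A)$, for $A\in\mathbb{R}^{m\times r}$ of full column rank, denotes a matrix $AG$ with $G\in\mathbb{R}^{r\times r}$ invertible and $(AG)^T(AG)=I$. *)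

theory Defs
  imports "HOL-Analysis.Analysis"
begin

notation transpose ("(_\<^sup>T)" [1000] 999)

text \<open>
  An \<open>m \<times> n\<close> real matrix is an element of \<^typ>\<open>real ^ 'n ^ 'm\<close>. The library norm of
  this type is the Frobenius norm:
\<close>

lemma norm_matrix_eq_Frobenius:
  fixes A :: "real ^ 'n ^ 'm"
  shows "norm A = sqrt (\<Sum>i\<in>UNIV. \<Sum>j\<in>UNIV. (A $ i $ j)\<^sup>2)"
  by (simp add: norm_vec_def L2_set_def sum_nonneg)

definition orth_compl_proj :: "real ^ 'r ^ 'm \<Rightarrow> real ^ 'm ^ 'm" where
  "orth_compl_proj U = mat 1 - U ** U\<^sup>T"

definition gram_inv :: "real ^ 'r ^ 'n \<Rightarrow> real ^ 'r ^ 'r" where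
  "gram_inv Z = matrix_inv (Z\<^sup>T ** Z)"

text \<open>
  The so-DORK corrections for \<open>X = U ** Z\<^sup>T\<close>. The coefficient \<open>L\<^sub>j\<close> of the perturbation
  series is \<open>L j\<close>; the \<open>j\<close>-th correction uses only \<open>L 1, \<dots>, L j\<close>.
\<close>

definition dU1 :: "(nat \<Rightarrow> real ^ 'n ^ 'm) \<Rightarrow> real ^ 'r ^ 'm \<Rightarrow> real ^ 'r ^ 'n \<Rightarrow> real ^ 'r ^ 'm" where
  "dU1 L U Z = orth_compl_proj U ** L 1 ** Z ** gram_inv Z"

definition dU2 :: "(nat \<Rightarrow> real ^ 'n ^ 'm) \<Rightarrow> real ^ 'r ^ 'm \<Rightarrow> real ^ 'r ^ 'n \<Rightarrow> real ^ 'r ^ 'm" where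
  "dU2 L U Z =
    (let D1 = dU1 L U Z in
      (orth_compl_proj U ** (L 1 ** (L 1)\<^sup>T ** U + L 2 ** Z)
       - D1 ** (U\<^sup>T ** L 1 ** Z + Z\<^sup>T ** (L 1)\<^sup>T ** U)) ** gram_inv Z)"

definition dU3 :: "(nat \<Rightarrow> real ^ 'n ^ 'm) \<Rightarrow> real ^ 'r ^ 'm \<Rightarrow> real ^ 'r ^ 'n \<Rightarrow> real ^ 'r ^ 'm" where
  "dU3 L U Z =
    (let D1 = dU1 L U Z; D2 = dU2 L U Z in
      (orth_compl_proj U **
         (L 1 ** (L 1)\<^sup>T ** D1 + (L 1 ** (L 2)\<^sup>T + L 2 ** (L 1)\<^sup>T) ** U + L 3 ** Z)
       - D2 ** (U\<^sup>T ** L 1 ** Z + Z\<^sup>T ** (L 1)\<^sup>T ** U)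
       - D1 ** (U\<^sup>T ** L 2 ** Z + Z\<^sup>T ** (L 2)\<^sup>T ** U + U\<^sup>T ** L 1 ** (L 1)\<^sup>T ** U
                + D1\<^sup>T ** L 1 ** Z + Z\<^sup>T ** (L 1)\<^sup>T ** D1 - D1\<^sup>T ** D1 ** Z\<^sup>T ** Z))
      ** gram_inv Z)"

definition dU4 :: "(nat \<Rightarrow> real ^ 'n ^ 'm) \<Rightarrow> real ^ 'r ^ 'm \<Rightarrow> real ^ 'r ^ 'n \<Rightarrow> real ^ 'r ^ 'm" where
  "dU4 L U Z =
    (let D1 = dU1 L U Z; D2 = dU2 L U Z; D3 = dU3 L U Z in
      (orth_compl_proj U **
         (L 1 ** (L 1)\<^sup>T ** D2 + (L 1 ** (L 2)\<^sup>T + L 2 ** (L 1)\<^sup>T) ** D1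
          + (L 1 ** (L 3)\<^sup>T + L 3 ** (L 1)\<^sup>T + L 2 ** (L 2)\<^sup>T) ** U + L 4 ** Z)
       - D3 ** (U\<^sup>T ** L 1 ** Z + Z\<^sup>T ** (L 1)\<^sup>T ** U)
       - D2 ** (U\<^sup>T ** L 2 ** Z + Z\<^sup>T ** (L 2)\<^sup>T ** U + U\<^sup>T ** L 1 ** (L 1)\<^sup>T ** U
                + D1\<^sup>T ** L 1 ** Z + Z\<^sup>T ** (L 1)\<^sup>T ** D1 - D1\<^sup>T ** D1 ** Z\<^sup>T ** Z)
       - D1 ** (U\<^sup>T ** L 3 ** Z + Z\<^sup>T ** (L 3)\<^sup>T ** U
                + U\<^sup>T ** (L 2 ** (L 1)\<^sup>T + L 1 ** (L 2)\<^sup>T) ** U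
                + D1\<^sup>T ** L 2 ** Z + Z\<^sup>T ** (L 2)\<^sup>T ** D1
                + U\<^sup>T ** L 1 ** (L 1)\<^sup>T ** D1 + D1\<^sup>T ** L 1 ** (L 1)\<^sup>T ** U
                + D2\<^sup>T ** L 1 ** Z + Z\<^sup>T ** (L 1)\<^sup>T ** D2
                - D1\<^sup>T ** D2 ** Z\<^sup>T ** Z - D2\<^sup>T ** D1 ** Z\<^sup>T ** Z
                - D1\<^sup>T ** D1 ** U\<^sup>T ** L 1 ** Z - D1\<^sup>T ** D1 ** Z\<^sup>T ** (L 1)\<^sup>T ** U))
      ** gram_inv Z)"

text \<open>The value outside \<open>j \<in> {1, 2, 3, 4}\<close> is a dummy; the scheme is only used for orders up to 4.\<close>

definition dU ::
  "nat \<Rightarrow> (nat \<Rightarrow> real ^ 'n ^ 'm) \<Rightarrow> real ^ 'r ^ 'm \<Rightarrow> real ^ 'r ^ 'n \<Rightarrow> real ^ 'r ^ 'm" where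
  "dU j L U Z =
    (if j = 1 then dU1 L U Z
     else if j = 2 then dU2 L U Z
     else if j = 3 then dU3 L U Z
     else if j = 4 then dU4 L U Z
     else 0)"

text \<open>
  \<open>orth\<close> is not a specific algorithm (QR, SVD, \<dots>): any function returning, for each matrix
  of full column rank, an orthonormal basis of its column space is admissible. Nothing is
  required of its values on rank-deficient matrices.
\<close>

definition is_orthonormalization :: "(real ^ 'r ^ 'm \<Rightarrow> real ^ 'r ^ 'm) \<Rightarrow> bool" where
  "is_orthonormalization orth \<longleftrightarrow>
    (\<forall>A. rank A = CARD('r) \<longrightarrow>
      (\<exists>G :: real ^ 'r ^ 'r. invertible G \<and> orth A = A ** G \<and> (A ** G)\<^sup>T ** (A ** G) = mat 1))"

definition so_dork_U ::
  "(real ^ 'r ^ 'm \<Rightarrow> real ^ 'r ^ 'm) \<Rightarrow> nat \<Rightarrow> real \<Rightarrow> (nat \<Rightarrow> real ^ 'n ^ 'm)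
    \<Rightarrow> real ^ 'r ^ 'm \<Rightarrow> real ^ 'r ^ 'n \<Rightarrow> real ^ 'r ^ 'm" where
  "so_dork_U orth k dt L U Z = orth (U + (\<Sum>j = 1..k. dt ^ j *\<^sub>R dU j L U Z))"

definition so_dork_Z ::
  "(real ^ 'r ^ 'm \<Rightarrow> real ^ 'r ^ 'm) \<Rightarrow> nat \<Rightarrow> real \<Rightarrow> (nat \<Rightarrow> real ^ 'n ^ 'm) \<Rightarrow> real ^ 'n ^ 'm
    \<Rightarrow> real ^ 'r ^ 'm \<Rightarrow> real ^ 'r ^ 'n \<Rightarrow> real ^ 'r ^ 'n" where
  "so_dork_Z orth k dt L Lbar U Z = (U ** Z\<^sup>T + dt *\<^sub>R Lbar)\<^sup>T ** so_dork_U orth k dt L U Z"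

definition so_dork_step ::
  "(real ^ 'r ^ 'm \<Rightarrow> real ^ 'r ^ 'm) \<Rightarrow> nat \<Rightarrow> real \<Rightarrow> (nat \<Rightarrow> real ^ 'n ^ 'm) \<Rightarrow> real ^ 'n ^ 'm
    \<Rightarrow> real ^ 'r ^ 'm \<Rightarrow> real ^ 'r ^ 'n \<Rightarrow> real ^ 'n ^ 'm" where
  "so_dork_step orth k dt L Lbar U Z =
    so_dork_U orth k dt L U Z ** (so_dork_Z orth k dt L Lbar U Z)\<^sup>T"

end

theory Submission
  imports Defs
begin

text \<open>
  Every correction has its columns in the orthogonal complement of the column space of \<open>U\<close>: each
  summand of its defining formula starts with \<open>I - U U\<^sup>T\<close> or with an earlier correction. Hence
  \<open>A = U + \<Sum>\<^sub>j dt\<^sup>j U\<^sub>j\<close>, with \<open>U\<^sub>j\<close> the \<open>j\<close>-th correction, satisfies \<open>U\<^sup>T A = I\<close>. In particular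
  \<open>A\<close> never loses rank, whatever the step size and the \<open>L\<^sub>j\<close> are, so the orthonormalization is
  guaranteed to return some \<open>Q\<close> with \<open>Q\<^sup>T Q = I\<close>. One step of the scheme then computes
  \<open>Q Q\<^sup>T (X + dt Lbar)\<close>, an orthogonal projection of the unprojected step; orthogonal projections
  do not increase the Frobenius norm.
\<close>

text \<open>
  The Frobenius norm comes from the inner product \<open>\<Sum>\<^sub>i\<^sub>j A\<^sub>i\<^sub>j B\<^sub>i\<^sub>j\<close>, in which left multiplications
  have their transposes as adjoints. This reduces the contraction property below to
  the Cauchy-Schwarz inequality.
\<close>

lemma inner_matrix_mult_left:
  fixes A :: "real ^ 'b ^ 'a" and B :: "real ^ 'c ^ 'b" and C :: "real ^ 'c ^ 'a"
  shows "(A ** B) \<bullet> C = B \<bullet> (A\<^sup>T ** C)"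
proof -
  have "(A ** B) \<bullet> C = (\<Sum>i\<in>UNIV. \<Sum>j\<in>UNIV. \<Sum>l\<in>UNIV. A $ i $ l * B $ l $ j * C $ i $ j)"
    by (simp add: inner_vec_def matrix_matrix_mult_def sum_distrib_right)
  also have "\<dots> = (\<Sum>i\<in>UNIV. \<Sum>l\<in>UNIV. \<Sum>j\<in>UNIV. A $ i $ l * B $ l $ j * C $ i $ j)"
    by (rule sum.cong[OF refl], rule sum.swap)
  also have "\<dots> = (\<Sum>l\<in>UNIV. \<Sum>i\<in>UNIV. \<Sum>j\<in>UNIV. A $ i $ l * B $ l $ j * C $ i $ j)"
    by (rule sum.swap)
  also have "\<dots> = (\<Sum>l\<in>UNIV. \<Sum>j\<in>UNIV. \<Sum>i\<in>UNIV. A $ i $ l * B $ l $ j * C $ i $ j)"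
    by (rule sum.cong[OF refl], rule sum.swap)
  also have "\<dots> = B \<bullet> (A\<^sup>T ** C)"
    by (simp add: inner_vec_def matrix_matrix_mult_def transpose_def sum_distrib_left mult_ac)
  finally show ?thesis .
qed

lemma norm_orthonormal_projection_le:
  fixes Q :: "real ^ 'r ^ 'm" and Y :: "real ^ 'n ^ 'm"
  assumes "Q\<^sup>T ** Q = mat 1"
  shows "norm (Q ** (Q\<^sup>T ** Y)) \<le> norm Y"
proof -
  let ?W = "Q ** (Q\<^sup>T ** Y)"
  have "?W \<bullet> ?W = (Q\<^sup>T ** Y) \<bullet> (Q\<^sup>T ** ?W)"
    by (rule inner_matrix_mult_left)
  also have "\<dots> = (Q\<^sup>T ** Y) \<bullet> (Q\<^sup>T ** Y)"
    using assms by (simp add: matrix_mul_assoc)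
  also have "\<dots> = Y \<bullet> ?W"
    by (simp add: inner_matrix_mult_left)
  finally have "(norm ?W)\<^sup>2 = Y \<bullet> ?W"
    by (simp add: power2_norm_eq_inner)
  also have "\<dots> \<le> norm Y * norm ?W"
    by (rule norm_cauchy_schwarz)
  finally have "norm ?W * norm ?W \<le> norm Y * norm ?W"
    by (simp add: power2_eq_square)
  then show ?thesis
    by (cases "norm ?W = 0") (auto simp: mult_le_cancel_right)
qed

lemma full_column_rank_if_left_inverse:
  fixes A :: "real ^ 'r ^ 'm" and B :: "real ^ 'm ^ 'r"
  assumes "B ** A = mat 1"
  shows "rank A = CARD('r)"
proof -
  have "CARD('r) = rank (B ** A)"
    using assms by (simp add: rank_I)
  also have "\<dots> \<le> rank A"
    by (rule rank_mul_le_right)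
  finally show ?thesis
    using rank_bound[of A] by simp
qed

lemma matrix_mul_sum_right:
  fixes A :: "real ^ 'b ^ 'a" and f :: "'i \<Rightarrow> real ^ 'c ^ 'b"
  shows "A ** (\<Sum>i\<in>S. f i) = (\<Sum>i\<in>S. A ** f i)"
  by (induction S rule: infinite_finite_induct) (simp_all add: matrix_add_ldistrib)

lemma matrix_mul_diff_right:
  fixes A :: "real ^ 'b ^ 'a" and B C :: "real ^ 'c ^ 'b"
  shows "A ** (B - C) = A ** B - A ** C"
  by (simp add: matrix_matrix_mult_def vec_eq_iff right_diff_distrib sum_subtractf)

lemma transpose_mul_orth_compl_proj:
  fixes U :: "real ^ 'r ^ 'm"
  assumes "U\<^sup>T ** U = mat 1"
  shows "U\<^sup>T ** orth_compl_proj U = 0"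
  using assms
  by (simp add: orth_compl_proj_def matrix_mul_diff_right matrix_mul_assoc)

lemma transpose_mul_dU:
  fixes U :: "real ^ 'r ^ 'm" and Z :: "real ^ 'r ^ 'n" and L :: "nat \<Rightarrow> real ^ 'n ^ 'm"
  assumes "U\<^sup>T ** U = mat 1"
  shows "U\<^sup>T ** dU j L U Z = 0"
proof -
  note P = transpose_mul_orth_compl_proj[OF assms]
  \<comment> \<open>Only the leftmost factor of each summand matters; the formulas are abstracted to
    \<open>(P M - D\<^sub>a N\<^sub>a - \<dots>) G\<close> so that the long inner factors are never expanded.\<close>
  have proj: "U\<^sup>T ** (orth_compl_proj U ** M) = 0" for M :: "real ^ 'r ^ 'm"
    by (simp add: matrix_mul_assoc P)
  have factor: "U\<^sup>T ** (D ** N) = 0" if "U\<^sup>T ** D = 0" for D :: "real ^ 'r ^ 'm" and N :: "real ^ 'r ^ 'r"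
    using that by (simp add: matrix_mul_assoc)
  have diff: "U\<^sup>T ** (D - E) = 0" if "U\<^sup>T ** D = 0" "U\<^sup>T ** E = 0" for D E :: "real ^ 'r ^ 'm"
    using that by (simp add: matrix_mul_diff_right)
  have 1: "U\<^sup>T ** dU1 L U Z = 0"
    unfolding dU1_def by (simp add: matrix_mul_assoc P)
  have 2: "U\<^sup>T ** dU2 L U Z = 0"
    unfolding dU2_def Let_def by (intro factor diff proj 1)
  have 3: "U\<^sup>T ** dU3 L U Z = 0"
    unfolding dU3_def Let_def by (intro factor diff proj 1 2)
  have 4: "U\<^sup>T ** dU4 L U Z = 0"
    unfolding dU4_def Let_def by (intro factor diff proj 1 2 3)
  show ?thesis
    by (simp add: dU_def 1 2 3 4)
qed

lemma transpose_mul_corrected_basis: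
  fixes U :: "real ^ 'r ^ 'm" and Z :: "real ^ 'r ^ 'n" and L :: "nat \<Rightarrow> real ^ 'n ^ 'm"
  assumes "U\<^sup>T ** U = mat 1"
  shows "U\<^sup>T ** (U + (\<Sum>j = 1..k. dt ^ j *\<^sub>R dU j L U Z)) = mat 1"
proof -
  have "U\<^sup>T ** (dt ^ j *\<^sub>R dU j L U Z) = 0" for j
    using transpose_mul_dU[OF assms, of j L Z]
    by (simp only: matrix_scalar_ac scaleR_zero_right flip: scalar_matrix_assoc)
  then show ?thesis
    using assms by (simp add: matrix_add_ldistrib matrix_mul_sum_right)
qed

lemma so_dork_U_orthonormal:
  fixes U :: "real ^ 'r ^ 'm" and Z :: "real ^ 'r ^ 'n" and L :: "nat \<Rightarrow> real ^ 'n ^ 'm"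
  assumes "U\<^sup>T ** U = mat 1" and "is_orthonormalization orth"
  shows "(so_dork_U orth k dt L U Z)\<^sup>T ** so_dork_U orth k dt L U Z = mat 1"
proof -
  let ?A = "U + (\<Sum>j = 1..k. dt ^ j *\<^sub>R dU j L U Z)"
  have "rank ?A = CARD('r)"
    by (rule full_column_rank_if_left_inverse[OF transpose_mul_corrected_basis[OF assms(1)]])
  then have "(orth ?A)\<^sup>T ** orth ?A = mat 1"
    using assms(2) unfolding is_orthonormalization_def by auto
  then show ?thesis
    by (simp only: so_dork_U_def)
qed

theorem lemma5p1:
  fixes X Lbar :: "real ^ 'n ^ 'm"
    and U :: "real ^ 'r ^ 'm"
    and Z :: "real ^ 'r ^ 'n"
    and L :: "nat \<Rightarrow> real ^ 'n ^ 'm"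
    and k :: nat
    and dt :: real
    and orth :: "real ^ 'r ^ 'm \<Rightarrow> real ^ 'r ^ 'm"
  assumes "X = U ** Z\<^sup>T"
    and "rank X = CARD('r)"
    and "U\<^sup>T ** U = mat 1"
    and "rank Z = CARD('r)"
    and "k \<in> {1, 2, 3, 4}"
    and "dt *\<^sub>R Lbar = (\<Sum>j = 1..k. dt ^ j *\<^sub>R L j)"
    and "is_orthonormalization orth"
  shows "norm (so_dork_step orth k dt L Lbar U Z) \<le> norm (X + dt *\<^sub>R Lbar)"
proof -
  let ?Q = "so_dork_U orth k dt L U Z"
  have "so_dork_step orth k dt L Lbar U Z = ?Q ** (?Q\<^sup>T ** (X + dt *\<^sub>R Lbar))"
    using assms(1) by (simp add: so_dork_step_def so_dork_Z_def matrix_transpose_mul)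
  then show ?thesis
    using norm_orthonormal_projection_le[OF so_dork_U_orthonormal[OF assms(3,7)]] by simp
qed

end
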